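(* Let $B$ be a derivation-finite algebra over a field $\mathbf{k}$ and let $\mathscr{L}$ be a solvable Lie subalgebra of $\operatorname{Der}_{\mathbf{k}}(B)$. If $\mathscr{L}$ has a generating set (as a Lie algebra) that is included in $\operatorname{LFD}_{\mathbf{k}}(B)$ and closed under the Lie bracket, then $\mathscr{L}$ is weakly locally finite.
   Context: An algebra over a field $\mathbf{k}$ is a $\mathbf{k}$-vector space $B$ together with an arbitrary $\mathbf{k}$-bilinear map $B\times B\to B$, $(x,y)\mapsto x\cdot y$ (not assumed commutative, associative or unital). A $\mathbf{k}$-derivation of $B$ is a $\mathbf{k}$-linear map $D:B\to B$ with $D(x\cdot y)=D(x)\cdot y+x\cdot D(y)$ for all $x,y\in B$. The set $\operatorname{Der}_{\mathbf{k}}(B)$ of all $\mathbf{k}$-derivations of $B$ is a Lie algebra over $\mathbf{k}$ with bracket $[D,E]=D\circ E-E\circ D$. $B$ is derivation-finite if there exists a finite subset $F$ of $B$ such that the only $D\in\operatorname{Der}_{\mathbf{k}}(B)$ satisfying $D(x)=0$ for all $x\in F$ is $D=0$. A subset $\Delta$ of $\operatorname{Der}_{\mathbf{k}}(B)$ is locally finite if for each $b\in B$ there exists a finite dimensional $\mathbf{k}$-linear subspace $U$ of $B$ such that $b\in U$ and $D(U)\subseteq U$ for all $D\in\Delta$. It is weakly locally finite if every finite subset of $\Delta$ is locally finite. A derivation $D\in\operatorname{Der}_{\mathbf{k}}(B)$ is locally finite if $\{D\}$ is a locally finite set; $\operatorname{LFD}_{\mathbf{k}}(B)$ denotes the set of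 locally finite $\mathbf{k}$-derivations of $B$. A subset $S$ of $\operatorname{Der}_{\mathbf{k}}(B)$ is closed under the Lie bracket if $[D,E]\in S$ for all $D,E\in S$. For a Lie algebra $\mathscr{L}$, $\mathscr{L}'$ denotes the Lie subalgebra of $\mathscr{L}$ generated by $\{[x,y]\mid x,y\in\mathscr{L}\}$; $\mathscr{L}^{(0)}=\mathscr{L}$ and $\mathscr{L}^{(n+1)}=(\mathscr{L}^{(n)})'$ for $n\ge 0$. $\mathscr{L}$ is solvable if $\mathscr{L}^{(d)}=0$ for some $d\in\mathbb{N}$. *)

theory Defs
  imports Complex_Main "HOL-Library.Function_Algebras"
begin

locale nonassoc_algebra = vector_space scale
  for scale :: "'k::field \<Rightarrow> 'b::ab_group_add \<Rightarrow> 'b" (infixr \<open>*s\<close> 75) +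
  fixes mult :: "'b \<Rightarrow> 'b \<Rightarrow> 'b" (infixl \<open>\<cdot>\<close> 70)
  assumes linear_mult_right: "Vector_Spaces.linear scale scale (\<lambda>y. x \<cdot> y)"
    and linear_mult_left: "Vector_Spaces.linear scale scale (\<lambda>x. x \<cdot> y)"

(* Addition, subtraction and zero on 'b => 'b are the pointwise operations of
   Function_Algebras; the scalar action is given the prefix map. *)
sublocale nonassoc_algebra \<subseteq> map: vector_space "\<lambda>c (D :: 'b \<Rightarrow> 'b) x. c *s D x"
  by unfold_locales (auto simp: fun_eq_iff algebra_simps)

definition lie_bracket :: "('b::ab_group_add \<Rightarrow> 'b) \<Rightarrow> ('b \<Rightarrow> 'b) \<Rightarrow> 'b \<Rightarrow> 'b"
  where "lie_bracket D E = (D \<circ> E) - (E \<circ> D)"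

definition bracket_closed :: "('b::ab_group_add \<Rightarrow> 'b) set \<Rightarrow> bool"
  where "bracket_closed S \<longleftrightarrow> (\<forall>D\<in>S. \<forall>E\<in>S. lie_bracket D E \<in> S)"

context nonassoc_algebra
begin

definition Der :: "('b \<Rightarrow> 'b) set"
  where "Der = {D. Vector_Spaces.linear scale scale D \<and> (\<forall>x y. D (x \<cdot> y) = D x \<cdot> y + x \<cdot> D y)}"

definition derivation_finite :: bool
  where "derivation_finite \<longleftrightarrow>
    (\<exists>F. finite F \<and> (\<forall>D\<in>Der. (\<forall>x\<in>F. D x = 0) \<longrightarrow> D = 0))"

definition locally_finite :: "('b \<Rightarrow> 'b) set \<Rightarrow> bool"
  where "locally_finite \<Delta> \<longleftrightarrow>
    (\<forall>b. \<exists>U. subspace U \<and> (\<exists>X. finite X \<and> U = span X) \<and> b \<in> U \<and> (\<forall>D\<in>\<Delta>. D ` U \<subseteq> U))"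

definition weakly_locally_finite :: "('b \<Rightarrow> 'b) set \<Rightarrow> bool"
  where "weakly_locally_finite \<Delta> \<longleftrightarrow> (\<forall>\<Phi>. finite \<Phi> \<and> \<Phi> \<subseteq> \<Delta> \<longrightarrow> locally_finite \<Phi>)"

definition LFD :: "('b \<Rightarrow> 'b) set"
  where "LFD = {D \<in> Der. locally_finite {D}}"

definition lie_subalgebra :: "('b \<Rightarrow> 'b) set \<Rightarrow> bool"
  where "lie_subalgebra L \<longleftrightarrow> L \<subseteq> Der \<and> map.subspace L \<and> bracket_closed L"

definition lie_generated :: "('b \<Rightarrow> 'b) set \<Rightarrow> ('b \<Rightarrow> 'b) set"
  where "lie_generated S = lie_subalgebra hull S"

(* The generated subalgebra is formed inside Der; by lie_generated_subset this agrees with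
   forming it inside L whenever L is a Lie subalgebra. *)
definition lie_derived :: "('b \<Rightarrow> 'b) set \<Rightarrow> ('b \<Rightarrow> 'b) set"
  where "lie_derived L = lie_generated {lie_bracket D E | D E. D \<in> L \<and> E \<in> L}"

primrec derived_series :: "('b \<Rightarrow> 'b) set \<Rightarrow> nat \<Rightarrow> ('b \<Rightarrow> 'b) set"
  where "derived_series L 0 = L"
  | "derived_series L (Suc n) = lie_derived (derived_series L n)"

definition lie_solvable :: "('b \<Rightarrow> 'b) set \<Rightarrow> bool"
  where "lie_solvable L \<longleftrightarrow> (\<exists>d. derived_series L d = {0})"

lemma linear_scale_iff: "Vector_Spaces.linear scale scale D \<longleftrightarrow>
    (\<forall>x y. D (x + y) = D x + D y) \<and> (\<forall>c x. D (c *s x) = c *s D x)"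
  by (simp add: Vector_Spaces.linear_iff vector_space_axioms)

lemma mult_simps:
  "x \<cdot> (y + z) = x \<cdot> y + x \<cdot> z" "(x + y) \<cdot> z = x \<cdot> z + y \<cdot> z"
  "x \<cdot> (c *s y) = c *s (x \<cdot> y)" "(c *s x) \<cdot> y = c *s (x \<cdot> y)"
  using linear_mult_right[of x] linear_mult_left[of y] linear_mult_left[of z]
  by (auto simp: linear_scale_iff)

lemma mult_zero: "x \<cdot> 0 = 0" "0 \<cdot> x = 0"
  using mult_simps(1)[of x 0 0] mult_simps(2)[of 0 0 x] by simp_all

lemma mult_diff: "x \<cdot> (y - z) = x \<cdot> y - x \<cdot> z" "(x - y) \<cdot> z = x \<cdot> z - y \<cdot> z"
  using mult_simps(1)[of x "y - z" z] mult_simps(2)[of "x - y" y z] by simp_all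

lemma lie_bracket_in_Der:
  assumes "D \<in> Der" "E \<in> Der"
  shows "lie_bracket D E \<in> Der"
  using assms
  by (auto simp: Der_def lie_bracket_def linear_scale_iff mult_diff algebra_simps)

lemma lie_subalgebra_Der: "lie_subalgebra Der"
proof -
  have "map.subspace Der"
    unfolding map.subspace_def Der_def
    by (auto simp: linear_scale_iff mult_simps mult_zero scale_right_distrib add_ac scale_left_commute)
  then show ?thesis
    by (auto simp: lie_subalgebra_def bracket_closed_def lie_bracket_in_Der)
qed

lemma lie_subalgebra_lie_generated:
  assumes "S \<subseteq> Der"
  shows "lie_subalgebra (lie_generated S)"
proof -
  have "lie_generated S \<subseteq> Der"
    unfolding lie_generated_def by (intro hull_minimal assms lie_subalgebra_Der)
  moreover have "map.subspace (lie_generated S)"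
    unfolding lie_generated_def hull_def
    by (rule map.subspace_Inter) (auto simp: lie_subalgebra_def)
  ultimately show ?thesis
    by (auto simp: lie_subalgebra_def bracket_closed_def lie_generated_def hull_def)
qed

lemma lie_generated_subset:
  assumes "lie_subalgebra L" "S \<subseteq> L"
  shows "lie_generated S \<subseteq> L"
  unfolding lie_generated_def by (intro hull_minimal assms)

end

end

theory Submission
  imports Defs
begin

text \<open>
  A finite-dimensional Lie algebra of derivations with a basis \<open>p\<^sub>1, \<dots>, p\<^sub>n\<close> of locally finite
  elements acts locally finitely: as in the spanning half of the Poincare-Birkhoff-Witt theorem,
  reordering a product of \<open>p\<close>'s changes it only by shorter products, and in a long
  product some \<open>p\<^sub>i\<close> occurs so often that, once its occurrences have been brought next to the vector
  they act on, local finiteness of \<open>p\<^sub>i\<close> shortens the product. This is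
  \<open>almost_commuting_finite_invariant\<close>.

  So let \<open>G\<close> be the given generating set. Being closed under the bracket, it spans \<open>L\<close>, and a finite
  subset of \<open>L\<close> lies in the span of a finite \<open>H \<subseteq> G\<close>. Let \<open>N \<subseteq> G\<close> be the closure of \<open>H\<close> under the
  bracket. It remains to see that the Lie algebra spanned by \<open>N\<close> has finite dimension; a basis can
  then be chosen inside \<open>N\<close>, hence among the given locally finite derivations.

  Two observations give this. The first is that on a derivation-finite algebra a locally finite \<open>D\<close>
  is also locally finite in its adjoint action on the derivations (\<open>ad_finite_orbit\<close>), since
  derivations are determined by their values on a finite set. The second is an induction along the
  derived series \<open>L\<^sup>(\<^sup>n\<^sup>)\<close>, showing that \<open>N\<close> is spanned by finitely many of its elements modulo
  \<open>L\<^sup>(\<^sup>n\<^sup>)\<close> (\<open>finitely_spanned_modulo_step\<close>). If this holds for some \<open>n\<close>, then the relations expressing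
  the brackets of the chosen elements have finitely many error terms in \<open>L\<^sup>(\<^sup>n\<^sup>)\<close>. The adjoint action on
  \<open>L\<^sup>(\<^sup>n\<^sup>) / L\<^sup>(\<^sup>n\<^sup>+\<^sup>1\<^sup>)\<close> factors through \<open>L / L\<^sup>(\<^sup>n\<^sup>)\<close>, where the chosen elements span a Lie algebra, so by
  the reordering argument the error terms generate only finitely many new dimensions modulo
  \<open>L\<^sup>(\<^sup>n\<^sup>+\<^sup>1\<^sup>)\<close>. Solvability ends the induction at \<open>0\<close>.
\<close>

section \<open>Finite orbits of operators in a vector space\<close>

context vector_space
begin

lemma linear_maps_span_into:
  assumes "Vector_Spaces.linear scale scale g" "subspace S" "\<And>a. a \<in> A \<Longrightarrow> g a \<in> S" "x \<in> span A"
  shows "g x \<in> S"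
proof -
  interpret g: Vector_Spaces.linear scale scale g by fact
  show ?thesis
    using assms(4)
  proof (induction rule: span_induct_alt)
    case base
    then show ?case using assms(2) by (simp add: g.zero subspace_0)
  next
    case (step c a y)
    then show ?case
      using assms(2,3) by (simp add: g.add g.scale subspace_add subspace_scale)
  qed
qed

lemma span_Un_subspaceE:
  assumes "x \<in> span (A \<union> J)" "subspace J"
  obtains a where "a \<in> J" "x - a \<in> span A"
proof -
  obtain u a where "x = u + a" "u \<in> span A" "a \<in> span J"
    using assms(1) unfolding span_Un by auto
  then show thesis
    using that[of a] assms(2) by (metis add_diff_cancel_right' span_eq_iff)
qed

lemma finite_span_subset:
  assumes "finite A" "A \<subseteq> span N"
  obtains P where "finite P" "P \<subseteq> N" "A \<subseteq> span P"
proof -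
  have "\<forall>a\<in>A. \<exists>P. finite P \<and> P \<subseteq> N \<and> a \<in> span P"
  proof
    fix a assume "a \<in> A"
    then have "a \<in> span N" using assms(2) by auto
    then obtain T r where T: "finite T" "T \<subseteq> N" "a = (\<Sum>b\<in>T. scale (r b) b)"
      unfolding span_explicit by blast
    have "a \<in> span T"
      unfolding T(3) by (intro span_sum span_scale span_base)
    with T(1,2) show "\<exists>P. finite P \<and> P \<subseteq> N \<and> a \<in> span P" by blast
  qed
  then obtain P where P: "\<And>a. a \<in> A \<Longrightarrow> finite (P a) \<and> P a \<subseteq> N \<and> a \<in> span (P a)"
    by metis
  show thesis
  proof
    show "finite (\<Union>a\<in>A. P a)" "(\<Union>a\<in>A. P a) \<subseteq> N" using P assms(1) by auto
    show "A \<subseteq> span (\<Union>a\<in>A. P a)"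
    proof
      fix a assume "a \<in> A"
      then have "span (P a) \<subseteq> span (\<Union>a\<in>A. P a)" by (intro span_mono) auto
      then show "a \<in> span (\<Union>a\<in>A. P a)" using P[OF \<open>a \<in> A\<close>] by blast
    qed
  qed
qed

lemma subspace_of_finite_span:
  assumes "subspace S" "S \<subseteq> span X" "finite X"
  obtains Y where "finite Y" "Y \<subseteq> S" "S = span Y"
proof -
  obtain Y where Y: "Y \<subseteq> S" "independent Y" "S \<subseteq> span Y"
    using maximal_independent_subset[of S] by blast
  have "finite Y" using independent_span_bound[OF assms(3) Y(2)] Y(1) assms(2) by auto
  moreover have "S = span Y" using Y assms(1) by (simp add: span_minimal subset_antisym)
  ultimately show thesis using Y(1) that by blast
qed

text \<open>
  If no power of \<open>f\<close> applied to \<open>b\<close> were a combination of the lower ones, the vectors \<open>f\<^sup>j b\<close> would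
  be independent, and there would be more of them than \<open>card X\<close>.
\<close>

lemma finite_orbit_relation:
  fixes f :: "'b \<Rightarrow> 'b"
  assumes "finite X" and X: "\<And>n. (f ^^ n) b \<in> span X"
  obtains n where "(f ^^ n) b \<in> span ((\<lambda>j. (f ^^ j) b) ` {..<n})"
proof (rule ccontr)
  assume "\<not> thesis"
  then have new: "(f ^^ n) b \<notin> span ((\<lambda>j. (f ^^ j) b) ` {..<n})" for n using that by blast
  have indep: "independent ((\<lambda>j. (f ^^ j) b) ` {..<n}) \<and> card ((\<lambda>j. (f ^^ j) b) ` {..<n}) = n" for n
  proof (induction n)
    case (Suc n)
    moreover have "(f ^^ n) b \<notin> (\<lambda>j. (f ^^ j) b) ` {..<n}"
      using new[of n] span_base[of "(f ^^ n) b"] by metis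
    ultimately show ?case
      using new[of n] by (simp add: lessThan_Suc independent_insert)
  qed (simp add: independent_empty)
  have "card ((\<lambda>j. (f ^^ j) b) ` {..<Suc (card X)}) \<le> card X"
    using independent_span_bound[OF \<open>finite X\<close>, of "(\<lambda>j. (f ^^ j) b) ` {..<Suc (card X)}"]
      indep[of "Suc (card X)"] X by blast
  then show False using indep[of "Suc (card X)"] by simp
qed

end

lemma frequent_letter:
  assumes "finite P" "set w \<subseteq> P" "card P * n < length w"
  shows "\<exists>x\<in>P. n \<le> count_list w x"
proof (rule ccontr)
  assume "\<not> ?thesis"
  then have "(\<Sum>x\<in>set w. count_list w x) \<le> (\<Sum>x\<in>set w. n)"
    using assms(2) by (intro sum_mono) (auto simp: not_le intro: less_imp_le)
  also have "\<dots> \<le> card P * n" using assms(1,2) by (simp add: card_mono)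
  finally show False using assms(3) by (simp add: sum_count_set[OF order_refl])
qed

section \<open>Almost commuting operators\<close>

context vector_space
begin

text \<open>
  Everything is read modulo \<open>J\<close>. Filter the module generated by \<open>b\<close> by word length: \<open>X m\<close> is spanned
  by the words of length at most \<open>m\<close> in the operators, applied to \<open>b\<close>. By \<open>comm\<close> the operators commute
  on the associated graded module, which is cyclic; so a relation for \<open>f p\<close> at the single generator
  \<open>b\<close>, say \<open>f\<^sub>p\<^sup>N b \<in> X (N - 1)\<close>, makes \<open>f\<^sub>p\<^sup>N\<close> vanish on the whole graded module. A word longer than
  \<open>card P * N\<close> contains some letter at least \<open>N\<close> times, whence the filtration becomes stationary.

  The set \<open>I\<close> confines the commutation hypothesis: for the adjoint action on \<open>I / J\<close>, with \<open>J\<close>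
  containing \<open>[I, I]\<close>, it is satisfied on \<open>I\<close> only.
\<close>

proposition almost_commuting_finite_invariant:
  fixes f :: "'i \<Rightarrow> 'b \<Rightarrow> 'b"
  assumes "finite P" and lin: "\<And>p. p \<in> P \<Longrightarrow> Vector_Spaces.linear scale scale (f p)"
    and "b \<in> I" and I: "\<And>p v. p \<in> P \<Longrightarrow> v \<in> I \<Longrightarrow> f p v \<in> I"
    and J: "\<And>p v. p \<in> P \<Longrightarrow> v \<in> J \<Longrightarrow> f p v \<in> J"
    and orbit: "\<And>p. p \<in> P \<Longrightarrow> \<exists>X. finite X \<and> (\<forall>n. (f p ^^ n) b \<in> span X)"
    and comm: "\<And>p q v. p \<in> P \<Longrightarrow> q \<in> P \<Longrightarrow> v \<in> I \<Longrightarrow>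
      f p (f q v) - f q (f p v) \<in> span ((\<lambda>l. f l v) ` P \<union> J)"
  obtains Y where "finite Y" "Y \<subseteq> I" "b \<in> Y" "\<And>p y. p \<in> P \<Longrightarrow> y \<in> Y \<Longrightarrow> f p y \<in> span (Y \<union> J)"
proof -
  define Y where "Y m = (\<lambda>w. foldr f w b) ` {w. set w \<subseteq> P \<and> length w \<le> m}" for m
  define X where "X m = span (Y m \<union> J)" for m
  have sub: "subspace (X m)" for m by (simp add: X_def)
  have X_word: "foldr f w b \<in> X m" if "set w \<subseteq> P" "length w \<le> m" for w m
    using that unfolding X_def Y_def by (intro span_base) auto
  have X_mono: "X m \<subseteq> X n" if "m \<le> n" for m n
    using that unfolding X_def Y_def by (intro span_mono) auto
  have X_J: "v \<in> X m" if "v \<in> J" for v m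
    using that unfolding X_def by (intro span_base) auto
  have X_diff: "(v \<in> X m) = (u \<in> X m)" if "v - u \<in> X m" for u v m
    using that subspace_add[OF sub, of "v - u" m u] subspace_diff[OF sub, of v m "v - u"] by auto
  have X_trans: "v - u \<in> X m" if "v - z \<in> X m" "z - u \<in> X m" for u v z m
    using subspace_add[OF sub that] by simp
  have X_step: "f p v \<in> X (Suc m)" if "p \<in> P" "v \<in> X m" for p v m
  proof (rule linear_maps_span_into[OF lin[OF that(1)] sub _ that(2)[unfolded X_def]])
    fix a assume "a \<in> Y m \<union> J"
    then consider "a \<in> J" | w where "set w \<subseteq> P" "length w \<le> m" "a = foldr f w b"
      unfolding Y_def by blast
    then show "f p a \<in> X (Suc m)"
    proof cases
      case 1
      then show ?thesis using J that(1) X_J by blast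
    next
      case 2
      then show ?thesis using X_word[of "p # w" "Suc m"] that(1) by simp
    qed
  qed
  have f_diff: "f p (u - v) = f p u - f p v" if "p \<in> P" for p u v
  proof -
    interpret Vector_Spaces.linear scale scale "f p" by (rule lin[OF that])
    show ?thesis by (rule diff)
  qed
  have X_step_diff: "f p u - f p v \<in> X (Suc m)" if "p \<in> P" "u - v \<in> X m" for p u v m
    using X_step[OF that] f_diff[OF that(1)] by simp
  have word_I: "foldr f w b \<in> I" if "set w \<subseteq> P" for w
    using that by (induction w) (auto simp: I \<open>b \<in> I\<close>)
  have swap: "f p (f q (foldr f w b)) - f q (f p (foldr f w b)) \<in> X (Suc (length w))"
    if "p \<in> P" "q \<in> P" "set w \<subseteq> P" for p q w
  proof -
    have "f l (foldr f w b) \<in> X (Suc (length w))" if "l \<in> P" for l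
      using X_word[of "l # w" "Suc (length w)"] that \<open>set w \<subseteq> P\<close> by simp
    then have "(\<lambda>l. f l (foldr f w b)) ` P \<union> J \<subseteq> X (Suc (length w))"
      using X_J by blast
    then have "span ((\<lambda>l. f l (foldr f w b)) ` P \<union> J) \<subseteq> X (Suc (length w))"
      by (rule span_minimal[OF _ sub])
    then show ?thesis using comm[OF that(1,2) word_I[OF that(3)]] by blast
  qed
  \<comment> \<open>Moving one letter across a word costs only words of smaller length.\<close>
  have rotate: "f x (foldr f w b) - foldr f w (f x b) \<in> X (length w)" if "x \<in> P" "set w \<subseteq> P" for x w
    using that(2)
  proof (induction w)
    case Nil
    then show ?case by (simp add: subspace_0[OF sub])
  next
    case (Cons y w)
    have "f x (f y (foldr f w b)) - f y (f x (foldr f w b)) \<in> X (Suc (length w))"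
      using swap[of x y w] that(1) Cons.prems by simp
    moreover have "f y (f x (foldr f w b)) - f y (foldr f w (f x b)) \<in> X (Suc (length w))"
      using X_step_diff[OF _ Cons.IH] Cons.prems by simp
    ultimately show ?case using X_trans by simp
  qed
  \<comment> \<open>Hence all occurrences of a letter can be gathered next to \<open>b\<close>.\<close>
  have collect: "foldr f w b - foldr f (filter (\<lambda>y. y \<noteq> x) w @ replicate (count_list w x) x) b
      \<in> X (length w - 1)" if "x \<in> P" "set w \<subseteq> P" for x w
    using that(2)
  proof (induction w)
    case Nil
    then show ?case by (simp add: subspace_0[OF sub])
  next
    case (Cons y w)
    let ?v = "filter (\<lambda>y. y \<noteq> x) w @ replicate (count_list w x) x"
    show ?case
    proof (cases "w = []")
      case True
      then show ?thesis by (simp add: subspace_0[OF sub])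
    next
      case False
      have len: "length ?v = length w"
        by (induction w) auto
      have "f y (foldr f w b) - f y (foldr f ?v b) \<in> X (Suc (length w - 1))"
        by (rule X_step_diff) (use Cons in auto)
      then have first: "f y (foldr f w b) - f y (foldr f ?v b) \<in> X (length w)"
        using False by (cases w) auto
      show ?thesis
      proof (cases "y = x")
        case True
        have "f x (foldr f ?v b) - foldr f ?v (f x b) \<in> X (length ?v)"
          by (rule rotate[OF that(1)]) (use Cons.prems that(1) in auto)
        moreover have "foldr f ?v (f x b)
            = foldr f (filter (\<lambda>y. y \<noteq> x) w @ replicate (Suc (count_list w x)) x) b"
          by (simp add: replicate_append_same[symmetric] del: replicate_append_same)
        ultimately show ?thesis
          using X_trans[OF first, of "foldr f ?v (f x b)"] True len by simp
      next
        case False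
        then show ?thesis using first by simp
      qed
    qed
  qed
  have "\<forall>p\<in>P. \<exists>n. (f p ^^ n) b \<in> span ((\<lambda>j. (f p ^^ j) b) ` {..<n})"
    using orbit finite_orbit_relation by metis
  then obtain n where n: "\<And>p. p \<in> P \<Longrightarrow> (f p ^^ n p) b \<in> span ((\<lambda>j. (f p ^^ j) b) ` {..<n p})"
    by metis
  \<comment> \<open>A common bound for all exponents \<open>n p\<close>. The successor makes \<open>N\<close> positive, so that the
    subtractions of \<open>1\<close> from exponents that are at least \<open>N\<close> are not truncated.\<close>
  define N where "N = Suc (\<Sum>p\<in>P. n p)"
  have N: "n p < N" if "p \<in> P" for p
    using that \<open>finite P\<close> by (simp add: N_def less_Suc_eq_le member_le_sum)
  have power_X: "(f p ^^ k) b \<in> X m" if "p \<in> P" "k \<le> m" for p k m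
    using X_word[of "replicate k p" m] that by (auto simp: foldr_replicate set_replicate_conv_if)
  have high_power: "(f p ^^ k) b \<in> X (k - 1)" if "p \<in> P" "N \<le> k" for p k
  proof -
    have "(f p ^^ Suc (n p + j)) b \<in> X (n p + j)" for j
    proof (induction j)
      case 0
      have "(f p ^^ n p) b \<in> X (n p - 1)"
      proof (cases "n p")
        case 0
        then show ?thesis using n[OF that(1)] by (simp add: subspace_0[OF sub])
      next
        case (Suc i)
        have "span ((\<lambda>j. (f p ^^ j) b) ` {..<n p}) \<subseteq> X (n p - 1)"
          by (rule span_minimal[OF _ sub]) (use power_X that(1) Suc in auto)
        then show ?thesis using n[OF that(1)] by blast
      qed
      then show ?case
      proof (cases "n p")
        case 0
        \<comment> \<open>Here the relation says that \<open>b = 0\<close>, so that its image vanishes as well.\<close>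
        then have "b = 0" using n[OF that(1)] by simp
        then show ?thesis using 0 f_diff[OF that(1), of 0 0] by (simp add: subspace_0[OF sub])
      next
        case (Suc i)
        with \<open>(f p ^^ n p) b \<in> X (n p - 1)\<close> show ?thesis
          using X_step[OF that(1), of "(f p ^^ n p) b" i] by simp
      qed
    next
      case (Suc j)
      then show ?case using X_step[OF that(1) Suc] by simp
    qed
    from this[of "k - 1 - n p"] show ?thesis using N[OF that(1)] that(2) by simp
  qed
  \<comment> \<open>A word of length \<open>M + 1\<close> contains some letter at least \<open>N\<close> times, by the pigeonhole principle.\<close>
  define M where "M = card P * N"
  have long: "foldr f w b \<in> X M" if "set w \<subseteq> P" "length w \<le> Suc M" for w
  proof (cases "length w = Suc M")
    case False
    then show ?thesis using that X_word by simp
  next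
    case True
    then obtain x where x: "x \<in> P" "N \<le> count_list w x"
      using frequent_letter[OF \<open>finite P\<close> \<open>set w \<subseteq> P\<close>, of N] unfolding M_def by auto
    let ?v = "filter (\<lambda>y. y \<noteq> x) w"
    have len: "length ?v + count_list w x = length w" by (induction w) auto
    have push: "foldr f v z \<in> X (length v + m)" if "set v \<subseteq> P" "z \<in> X m" for v z m
      using that by (induction v) (auto simp: X_step)
    have "foldr f (?v @ replicate (count_list w x) x) b \<in> X (length ?v + (count_list w x - 1))"
      using push[OF _ high_power[OF x], of ?v] \<open>set w \<subseteq> P\<close>
      by (simp add: foldr_replicate subset_iff)
    moreover have "length ?v + (count_list w x - 1) = M"
      using len True x(2) N_def by linarith
    ultimately show ?thesis
      using X_diff[OF collect[OF x(1) that(1), unfolded True, simplified]] by simp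
  qed
  show thesis
  proof
    show "finite (Y M)" unfolding Y_def
      using finite_lists_length_le[OF \<open>finite P\<close>, of M] by auto
    show "Y M \<subseteq> I" unfolding Y_def using word_I by auto
    show "b \<in> Y M" unfolding Y_def by (auto intro!: image_eqI[of _ _ "[]"])
    fix p y assume "p \<in> P" "y \<in> Y M"
    then obtain w where w: "set w \<subseteq> P" "length w \<le> M" "y = foldr f w b" unfolding Y_def by blast
    then show "f p y \<in> span (Y M \<union> J)"
      using long[of "p # w"] \<open>p \<in> P\<close> unfolding X_def by simp
  qed
qed

end

section \<open>Lie algebras of derivations\<close>

context nonassoc_algebra
begin

lemma Der_linear: "D \<in> Der \<Longrightarrow> Vector_Spaces.linear scale scale D"
  by (simp add: Der_def)

lemma lie_bracket_linear:
  assumes "D \<in> Der"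
  shows "Vector_Spaces.linear (\<lambda>c (D :: 'b \<Rightarrow> 'b) x. c *s D x) (\<lambda>c D x. c *s D x) (lie_bracket D)"
  using assms
  by (auto simp: Vector_Spaces.linear_iff map.vector_space_axioms Der_def lie_bracket_def
      linear_scale_iff fun_eq_iff algebra_simps)

lemma lie_bracket_swap: "lie_bracket E D = - lie_bracket D E"
  by (simp add: lie_bracket_def)

lemma lie_bracket_spans_into:
  assumes "A \<subseteq> Der" "B \<subseteq> Der" "map.subspace S"
    and "\<And>a b. a \<in> A \<Longrightarrow> b \<in> B \<Longrightarrow> lie_bracket a b \<in> S"
    and "x \<in> map.span A" "y \<in> map.span B"
  shows "lie_bracket x y \<in> S"
proof -
  have "y \<in> Der"
    using map.span_minimal[OF assms(2)] lie_subalgebra_Der assms(6)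
    unfolding lie_subalgebra_def by blast
  have "lie_bracket a y \<in> S" if "a \<in> A" for a
    by (rule map.linear_maps_span_into[OF lie_bracket_linear assms(3) _ assms(6)])
      (use that assms(1,4) in auto)
  then have "lie_bracket y a \<in> S" if "a \<in> A" for a
    using that map.subspace_neg[OF assms(3)] lie_bracket_swap by metis
  then have "lie_bracket y x \<in> S"
    by (rule map.linear_maps_span_into[OF lie_bracket_linear[OF \<open>y \<in> Der\<close>] assms(3) _ assms(5)])
  then show ?thesis using map.subspace_neg[OF assms(3)] lie_bracket_swap by metis
qed

lemma bracket_closed_span:
  assumes "A \<subseteq> Der" "\<And>a b. a \<in> A \<Longrightarrow> b \<in> A \<Longrightarrow> lie_bracket a b \<in> map.span A"
  shows "bracket_closed (map.span A)"
  unfolding bracket_closed_def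
  using lie_bracket_spans_into[OF assms(1) assms(1) map.subspace_span assms(2)] by blast

text \<open>
  The reason why closure of the generating set under the bracket is so useful: the generated Lie
  algebra is then spanned, as a vector space, by the generators themselves.
\<close>

lemma lie_generated_bracket_closed:
  assumes "G \<subseteq> Der" "bracket_closed G"
  shows "lie_generated G = map.span G"
proof
  have "map.span G \<subseteq> Der"
    using map.span_minimal[OF assms(1)] lie_subalgebra_Der unfolding lie_subalgebra_def by blast
  moreover have "bracket_closed (map.span G)"
    by (rule bracket_closed_span[OF assms(1)])
      (use assms(2) in \<open>auto simp: bracket_closed_def intro: map.span_base\<close>)
  ultimately have "lie_subalgebra (map.span G)" by (simp add: lie_subalgebra_def)
  then show "lie_generated G \<subseteq> map.span G"
    by (rule lie_generated_subset) (rule map.span_superset)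
  show "map.span G \<subseteq> lie_generated G"
    using lie_subalgebra_lie_generated[OF assms(1)]
    by (intro map.span_minimal) (auto simp: lie_subalgebra_def lie_generated_def hull_subset)
qed

lemma bracket_closed_hull: "bracket_closed (bracket_closed hull H)"
  unfolding hull_def bracket_closed_def by blast

definition lie_ideal :: "('b \<Rightarrow> 'b) set \<Rightarrow> ('b \<Rightarrow> 'b) set \<Rightarrow> bool"
  where "lie_ideal I L \<longleftrightarrow> map.subspace I \<and> I \<subseteq> L \<and> (\<forall>x\<in>L. \<forall>y\<in>I. lie_bracket x y \<in> I)"

lemma Der_diff:
  assumes "D \<in> Der"
  shows "D (a - b) = D a - D b"
proof -
  interpret Vector_Spaces.linear scale scale D by (rule Der_linear[OF assms])
  show ?thesis by (rule diff)
qed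

lemma jacobi:
  assumes "x \<in> Der" "y \<in> Der" "z \<in> Der"
  shows "lie_bracket x (lie_bracket y z)
    = lie_bracket (lie_bracket x y) z + lie_bracket y (lie_bracket x z)"
proof -
  show ?thesis
    by (simp add: lie_bracket_def fun_eq_iff assms[THEN Der_diff])
qed

lemma lie_bracket_in_lie_derived:
  "D \<in> I \<Longrightarrow> E \<in> I \<Longrightarrow> lie_bracket D E \<in> lie_derived I"
  unfolding lie_derived_def lie_generated_def by (rule hull_inc) blast

text \<open>
  The brackets of elements of an ideal form a bracket-closed set, hence they span the derived algebra;
  that their span is again an ideal is the Jacobi identity.
\<close>

lemma lie_ideal_lie_derived:
  assumes L: "lie_subalgebra L" and I: "lie_ideal I L"
  shows "lie_ideal (lie_derived I) L"
proof -
  let ?B = "{lie_bracket D E | D E. D \<in> I \<and> E \<in> I}"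
  have "I \<subseteq> L" "L \<subseteq> Der" "map.subspace I" using L I by (auto simp: lie_subalgebra_def lie_ideal_def)
  have "?B \<subseteq> I" using I by (auto simp: lie_ideal_def)
  then have "?B \<subseteq> Der" "bracket_closed ?B"
    using \<open>I \<subseteq> L\<close> \<open>L \<subseteq> Der\<close> by (auto simp: bracket_closed_def) blast
  then have eq: "lie_derived I = map.span ?B"
    unfolding lie_derived_def by (rule lie_generated_bracket_closed)
  have "lie_bracket x z \<in> map.span ?B" if "x \<in> L" "z \<in> map.span ?B" for x z
  proof (rule map.linear_maps_span_into[OF lie_bracket_linear map.subspace_span _ that(2)])
    show "x \<in> Der" using that \<open>L \<subseteq> Der\<close> by blast
    fix a assume "a \<in> ?B"
    then obtain D E where a: "a = lie_bracket D E" "D \<in> I" "E \<in> I" by blast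
    moreover have "lie_bracket x D \<in> I" "lie_bracket x E \<in> I"
      using a that I by (auto simp: lie_ideal_def)
    moreover have "lie_bracket x a = lie_bracket (lie_bracket x D) E + lie_bracket D (lie_bracket x E)"
      unfolding a using a that \<open>I \<subseteq> L\<close> \<open>L \<subseteq> Der\<close> by (intro jacobi) auto
    ultimately show "lie_bracket x a \<in> map.span ?B"
      by (simp only:) (intro map.span_add map.span_base; blast)
  qed
  moreover have "map.span ?B \<subseteq> L"
    using map.span_minimal[OF \<open>?B \<subseteq> I\<close> \<open>map.subspace I\<close>] \<open>I \<subseteq> L\<close> by blast
  ultimately show ?thesis unfolding eq by (simp add: lie_ideal_def)
qed

lemma lie_ideal_derived_series:
  assumes "lie_subalgebra L"
  shows "lie_ideal (derived_series L n) L"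
proof (induction n)
  case 0
  then show ?case using assms by (auto simp: lie_ideal_def lie_subalgebra_def bracket_closed_def)
next
  case (Suc n)
  then show ?case using lie_ideal_lie_derived[OF assms] by simp
qed

section \<open>Local finiteness on the algebra and on its derivations\<close>

lemma locally_finite_finite_subset:
  assumes "locally_finite \<Delta>" "\<Delta> \<subseteq> Der" "finite F"
  obtains X where "finite X" "F \<subseteq> span X" "\<And>D. D \<in> \<Delta> \<Longrightarrow> D ` span X \<subseteq> span X"
proof -
  have "\<forall>b. \<exists>X. finite X \<and> b \<in> span X \<and> (\<forall>D\<in>\<Delta>. D ` span X \<subseteq> span X)"
    using assms(1) unfolding locally_finite_def by metis
  then obtain X where X: "\<And>b. finite (X b)" "\<And>b. b \<in> span (X b)"
    "\<And>b D. D \<in> \<Delta> \<Longrightarrow> D ` span (X b) \<subseteq> span (X b)" by metis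
  let ?X = "\<Union>b\<in>F. X b"
  have sub: "span (X b) \<subseteq> span ?X" if "b \<in> F" for b
    using that by (intro span_mono) auto
  show thesis
  proof
    show "finite ?X" using X(1) assms(3) by auto
    show "F \<subseteq> span ?X" using X(2) sub by blast
    fix D assume D: "D \<in> \<Delta>"
    show "D ` span ?X \<subseteq> span ?X"
    proof (rule image_subsetI)
      fix x assume x: "x \<in> span ?X"
      show "D x \<in> span ?X"
      proof (rule linear_maps_span_into[OF Der_linear subspace_span _ x])
        show "D \<in> Der" using D assms(2) by blast
        fix a assume "a \<in> ?X"
        then obtain b where "b \<in> F" "a \<in> X b" by blast
        then show "D a \<in> span ?X" using X(3)[OF D, of b] sub[of b] span_base[of a "X b"] by blast
      qed
    qed
  qed
qed

lemma evaluation_linear: "Vector_Spaces.linear (\<lambda>c (D :: 'b \<Rightarrow> 'b) x. c *s D x) scale (\<lambda>D. D x)"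
  by (simp add: Vector_Spaces.linear_iff map.vector_space_axioms vector_space_axioms)

lemma eval_span_into:
  assumes "D \<in> map.span P" "subspace S" "\<And>p. p \<in> P \<Longrightarrow> p x \<in> S"
  shows "D x \<in> S"
proof -
  interpret ev: Vector_Spaces.linear "\<lambda>c (D :: 'b \<Rightarrow> 'b) x. c *s D x" scale "\<lambda>D. D x"
    by (rule evaluation_linear)
  have "(\<lambda>D. D x) ` map.span P \<subseteq> S"
    unfolding ev.span_image[symmetric] using assms(2,3) by (intro span_minimal) auto
  then show ?thesis using assms(1) by blast
qed

text \<open>
  Restricting to \<open>X\<close> maps \<open>S\<close> into the finite-dimensional space of functions from \<open>X\<close> to \<open>span Z\<close>.
  The induction adds one point \<open>x\<close> at a time: the members of \<open>S\<close> that vanish on the earlier points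
  have their values at \<open>x\<close> in a subspace of \<open>span Z\<close>, and lifts of a spanning set of these values
  correct the value at \<open>x\<close> without disturbing the earlier ones.
\<close>

lemma finite_spanning_restrictions:
  assumes "map.subspace S" "finite X" "finite Z" "\<And>D x. D \<in> S \<Longrightarrow> x \<in> X \<Longrightarrow> D x \<in> span Z"
  shows "\<exists>Y. finite Y \<and> Y \<subseteq> S \<and> (\<forall>D\<in>S. \<exists>E\<in>map.span Y. \<forall>x\<in>X. D x = E x)"
  using assms(2,4)
proof (induction X)
  case empty
  then show ?case using map.span_zero by (intro exI[of _ "{}"]) auto
next
  case (insert x X)
  then obtain Y where Y: "finite Y" "Y \<subseteq> S" "\<forall>D\<in>S. \<exists>E\<in>map.span Y. \<forall>x\<in>X. D x = E x"
    by blast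
  define K where "K = {D \<in> S. \<forall>x\<in>X. D x = 0}"
  have K: "map.subspace K"
    using assms(1) unfolding K_def map.subspace_def by auto
  interpret ev: Vector_Spaces.linear "\<lambda>c (D :: 'b \<Rightarrow> 'b) x. c *s D x" scale "\<lambda>D. D x"
    by (rule evaluation_linear)
  have "subspace ((\<lambda>D. D x) ` K)" by (rule ev.subspace_image[OF K])
  moreover have "(\<lambda>D. D x) ` K \<subseteq> span Z" using insert.prems unfolding K_def by auto
  ultimately obtain V where V: "finite V" "V \<subseteq> (\<lambda>D. D x) ` K" "(\<lambda>D. D x) ` K = span V"
    using subspace_of_finite_span \<open>finite Z\<close> by metis
  obtain Y' where Y': "Y' \<subseteq> K" "finite Y'" "V = (\<lambda>D. D x) ` Y'"
    using finite_subset_image[OF V(1,2)] by blast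
  have "\<exists>E\<in>map.span (Y \<union> Y'). \<forall>y\<in>insert x X. D y = E y" if "D \<in> S" for D
  proof -
    obtain E where E: "E \<in> map.span Y" "\<forall>x\<in>X. D x = E x" using Y(3) \<open>D \<in> S\<close> by blast
    have "E \<in> S" using map.span_minimal[OF Y(2) assms(1)] E(1) by blast
    then have "D - E \<in> K"
      using that E(2) map.subspace_diff[OF assms(1)] unfolding K_def by auto
    then have "(D - E) x \<in> (\<lambda>D. D x) ` map.span Y'"
      using V(3) Y'(3) ev.span_image[of Y'] by blast
    then obtain E' where E': "E' \<in> map.span Y'" "(D - E) x = E' x" by blast
    have "E' \<in> K" using map.span_minimal[OF Y'(1) K] E'(1) by blast
    then have "\<forall>y\<in>insert x X. D y = (E + E') y"
      using E(2) E'(2) unfolding K_def by (auto simp: algebra_simps)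
    moreover have "E + E' \<in> map.span (Y \<union> Y')"
      using E(1) E'(1) map.span_mono[of Y "Y \<union> Y'"] map.span_mono[of Y' "Y \<union> Y'"]
      by (intro map.span_add) auto
    ultimately show ?thesis by blast
  qed
  then show ?case
    using Y(1,2) Y'(1,2) by (intro exI[of _ "Y \<union> Y'"]) (auto simp: K_def)
qed

text \<open>
  Choose finite-dimensional \<open>D\<close>-invariant subspaces, \<open>span X\<close> containing a finite set on which
  derivations are determined, and \<open>span Z\<close> containing the image of \<open>span X\<close> under \<open>E\<close>. The derivations
  that map \<open>span X\<close> into \<open>span Z\<close> form a subspace containing \<open>E\<close> and invariant under bracketing with
  \<open>D\<close>. It has finite dimension because its elements are determined by their restrictions to \<open>X\<close>.
\<close>

proposition ad_finite_orbit:
  assumes "derivation_finite" "D \<in> LFD" "E \<in> Der"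
  shows "\<exists>X. finite X \<and> (\<forall>n. (lie_bracket D ^^ n) E \<in> map.span X)"
proof -
  have D: "D \<in> Der" "locally_finite {D}" using assms(2) by (auto simp: LFD_def)
  obtain F where F: "finite F" "\<And>D. D \<in> Der \<Longrightarrow> \<forall>x\<in>F. D x = 0 \<Longrightarrow> D = 0"
    using assms(1) unfolding derivation_finite_def by blast
  obtain X where X: "finite X" "F \<subseteq> span X" "D ` span X \<subseteq> span X"
    using locally_finite_finite_subset[OF D(2) _ F(1)] D(1) by auto
  obtain Z where Z: "finite Z" "E ` X \<subseteq> span Z" "D ` span Z \<subseteq> span Z"
    using locally_finite_finite_subset[OF D(2) _ finite_imageI[OF X(1), of E]] D(1) by auto
  define S where "S = {E \<in> Der. E ` span X \<subseteq> span Z}"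
  have S: "map.subspace S"
    using lie_subalgebra_Der unfolding S_def lie_subalgebra_def map.subspace_def
    by (auto simp: image_subset_iff span_zero intro: span_add span_scale)
  have ext: "E = 0" if E: "E \<in> S" "\<forall>x\<in>X. E x = 0" for E
  proof (rule F(2))
    show "E \<in> Der" using E by (simp add: S_def)
    show "\<forall>x\<in>F. E x = 0"
    proof
      fix x assume "x \<in> F"
      then have "x \<in> span X" using X(2) by blast
      then have "E x \<in> {0}"
        using linear_maps_span_into[OF Der_linear[OF \<open>E \<in> Der\<close>], of "{0}" X x] E(2)
        by (simp add: subspace_def)
      then show "E x = 0" by simp
    qed
  qed
  have "E x \<in> span Z" if "E \<in> S" "x \<in> X" for E x
    using that span_base[of x X] unfolding S_def by blast
  then obtain Y where Y: "finite Y" "Y \<subseteq> S" "\<forall>D\<in>S. \<exists>E\<in>map.span Y. \<forall>x\<in>X. D x = E x"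
    using finite_spanning_restrictions[OF S X(1) Z(1)] by blast
  have S_Y: "E \<in> map.span Y" if "E \<in> S" for E
  proof -
    obtain E' where E': "E' \<in> map.span Y" "\<forall>x\<in>X. E x = E' x" using Y(3) \<open>E \<in> S\<close> by blast
    have "E' \<in> S" using map.span_minimal[OF Y(2) S] E'(1) by blast
    then have "E - E' = 0"
      using ext[of "E - E'"] map.subspace_diff[OF S that] E'(2) by simp
    then show ?thesis using E'(1) by simp
  qed
  have "(lie_bracket D ^^ n) E \<in> S" for n
  proof (induction n)
    case 0
    have "E x \<in> span Z" if "x \<in> span X" for x
      by (rule linear_maps_span_into[OF Der_linear[OF assms(3)] subspace_span _ that])
        (use Z(2) in auto)
    then show ?case using assms(3) by (auto simp: S_def)
  next
    case (Suc n)
    then show ?case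
    proof -
      have "lie_bracket D E' \<in> S" if E': "E' \<in> S" for E'
      proof -
        have "lie_bracket D E' x \<in> span Z" if "x \<in> span X" for x
        proof -
          have "D x \<in> span X" "E' x \<in> span Z" using X(3) E' that by (auto simp: S_def)
          then have "D (E' x) \<in> span Z" "E' (D x) \<in> span Z" using Z(3) E' by (auto simp: S_def)
          then show ?thesis by (simp add: lie_bracket_def span_diff)
        qed
        then show ?thesis using lie_bracket_in_Der[OF D(1)] E' by (auto simp: S_def)
      qed
      with Suc show ?thesis by simp
    qed
  qed
  then show ?thesis using S_Y Y(1) by blast
qed

section \<open>Descent along the derived series\<close>

text \<open>
  In applications \<open>N\<close> is the bracket closure of \<open>H\<close>, and \<open>I\<close> and \<open>J\<close> are consecutive terms of the
  derived series. The elements \<open>a p q \<in> I\<close> measure how far \<open>span P\<close> is from being closed under the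
  bracket. The reordering argument, applied to the adjoint action of \<open>P\<close> on \<open>I\<close> modulo \<open>J\<close>, encloses
  them in a finite set \<open>W\<close> whose span is invariant modulo \<open>J\<close>; its commutation hypothesis holds
  because \<open>[p, q]\<close> acts on \<open>I\<close> modulo \<open>J\<close> like an element of \<open>span P\<close>, the error \<open>a p q\<close> sending \<open>I\<close>
  into \<open>J\<close>. Then \<open>P \<union> W \<union> J\<close> spans a Lie algebra, which contains \<open>H\<close> and therefore \<open>N\<close>.
\<close>

lemma finitely_spanned_modulo_step:
  assumes N: "N \<subseteq> LFD" "bracket_closed N" "N \<subseteq> L"
    and L: "lie_subalgebra L" and "derivation_finite"
    and I: "lie_ideal I L" and J: "lie_ideal J L"
    and IJ: "\<And>x y. x \<in> I \<Longrightarrow> y \<in> I \<Longrightarrow> lie_bracket x y \<in> J"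
    and gen: "\<And>A. H \<subseteq> map.span A \<Longrightarrow> bracket_closed (map.span A) \<Longrightarrow> N \<subseteq> map.span A"
    and P: "finite P" "P \<subseteq> N" "H \<subseteq> P" "N \<subseteq> map.span (P \<union> I)"
  obtains P' where "finite P'" "P' \<subseteq> N" "N \<subseteq> map.span (P' \<union> J)"
proof -
  have LD: "L \<subseteq> Der" using L by (simp add: lie_subalgebra_def)
  have subI: "map.subspace I" and "I \<subseteq> L" "J \<subseteq> L"
    using I J by (auto simp: lie_ideal_def)
  have PL: "P \<subseteq> L" and PD: "P \<subseteq> Der" using P(2) N(3) LD by auto
  have "\<forall>p q. \<exists>a. p \<in> P \<longrightarrow> q \<in> P \<longrightarrow> a \<in> I \<and> lie_bracket p q - a \<in> map.span P"
  proof (intro allI)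
    fix p q
    show "\<exists>a. p \<in> P \<longrightarrow> q \<in> P \<longrightarrow> a \<in> I \<and> lie_bracket p q - a \<in> map.span P"
    proof (cases "p \<in> P \<and> q \<in> P")
      case True
      then have "lie_bracket p q \<in> map.span (P \<union> I)"
        using N(2) P(2,4) unfolding bracket_closed_def by blast
      then show ?thesis using map.span_Un_subspaceE[OF _ subI] by metis
    qed auto
  qed
  then obtain a where a: "\<And>p q. p \<in> P \<Longrightarrow> q \<in> P \<Longrightarrow> a p q \<in> I"
      "\<And>p q. p \<in> P \<Longrightarrow> q \<in> P \<Longrightarrow> lie_bracket p q - a p q \<in> map.span P"
    by metis
  let ?T = "(\<lambda>(p, q). a p q) ` (P \<times> P)"
  \<comment> \<open>Staying inside \<open>span N\<close> allows \<open>W\<close> to be expressed, at the end, by finitely many elements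
    of \<open>N\<close>, whose local finiteness is known.\<close>
  let ?I = "I \<inter> map.span N"
  have T: "?T \<subseteq> ?I"
  proof clarify
    fix p q assume pq: "p \<in> P" "q \<in> P"
    have "lie_bracket p q \<in> map.span N"
      using N(2) P(2) pq unfolding bracket_closed_def by (blast intro: map.span_base)
    moreover have "lie_bracket p q - a p q \<in> map.span N"
      using a(2)[OF pq] map.span_mono[OF P(2)] by blast
    ultimately have "lie_bracket p q - (lie_bracket p q - a p q) \<in> map.span N"
      by (rule map.span_diff)
    then show "a p q \<in> ?I" using a(1)[OF pq] by simp
  qed
  have "bracket_closed (map.span N)"
    using N LD by (intro bracket_closed_span) (auto simp: bracket_closed_def intro: map.span_base)
  have "\<exists>Y. finite Y \<and> Y \<subseteq> ?I \<and> t \<in> Y \<and> (\<forall>p\<in>P. \<forall>y\<in>Y. lie_bracket p y \<in> map.span (Y \<union> J))"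
    if "t \<in> ?T" for t
  proof (rule map.almost_commuting_finite_invariant[of P lie_bracket t ?I J])
    show "finite P" by fact
    show "t \<in> ?I" using T that by blast
    fix p assume p: "p \<in> P"
    then show "Vector_Spaces.linear (\<lambda>c D x. c *s D x) (\<lambda>c D x. c *s D x) (lie_bracket p)"
      using PD by (intro lie_bracket_linear) auto
    show "lie_bracket p v \<in> ?I" if "v \<in> ?I" for v
      using that p P(2) PL I \<open>bracket_closed (map.span N)\<close>
      unfolding lie_ideal_def bracket_closed_def by (blast intro: map.span_base)
    show "lie_bracket p v \<in> J" if "v \<in> J" for v
      using that p PL J unfolding lie_ideal_def by blast
    show "\<exists>X. finite X \<and> (\<forall>n. (lie_bracket p ^^ n) t \<in> map.span X)"
      using p P(2) N(1) \<open>t \<in> ?I\<close> \<open>I \<subseteq> L\<close> LD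
      by (intro ad_finite_orbit[OF \<open>derivation_finite\<close>]) auto
    fix q v assume q: "q \<in> P" and v: "v \<in> ?I"
    have D: "p \<in> Der" "q \<in> Der" "v \<in> Der" "a p q \<in> Der" "lie_bracket p q \<in> Der"
      using p q v PD \<open>I \<subseteq> L\<close> LD a(1)[OF p q] by (blast intro: lie_bracket_in_Der)+
    have "lie_bracket p (lie_bracket q v) - lie_bracket q (lie_bracket p v)
        = lie_bracket (lie_bracket p q) v"
      using jacobi[of p q v] D by simp
    also have "\<dots> = lie_bracket (lie_bracket p q - a p q) v + lie_bracket (a p q) v"
      by (simp add: lie_bracket_def fun_eq_iff Der_diff[OF D(3)])
    also have "\<dots> \<in> map.span ((\<lambda>l. lie_bracket l v) ` P \<union> J)"
    proof (rule map.span_add)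
      show "lie_bracket (lie_bracket p q - a p q) v \<in> map.span ((\<lambda>l. lie_bracket l v) ` P \<union> J)"
        by (rule lie_bracket_spans_into[OF PD _ map.subspace_span _ a(2)[OF p q], of "{v}"])
          (use D in \<open>auto intro: map.span_base\<close>)
      show "lie_bracket (a p q) v \<in> map.span ((\<lambda>l. lie_bracket l v) ` P \<union> J)"
        using IJ a(1)[OF p q] v by (auto intro: map.span_base)
    qed
    finally show "lie_bracket p (lie_bracket q v) - lie_bracket q (lie_bracket p v)
        \<in> map.span ((\<lambda>l. lie_bracket l v) ` P \<union> J)" .
  qed blast
  then obtain Y where Y: "\<And>t. t \<in> ?T \<Longrightarrow> finite (Y t) \<and> Y t \<subseteq> ?I \<and> t \<in> Y t"
      "\<And>t p y. t \<in> ?T \<Longrightarrow> p \<in> P \<Longrightarrow> y \<in> Y t \<Longrightarrow> lie_bracket p y \<in> map.span (Y t \<union> J)"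
    by metis
  define W where "W = (\<Union>t\<in>?T. Y t)"
  have W: "finite W" "W \<subseteq> ?I" "?T \<subseteq> W" using Y(1) P(1) unfolding W_def by blast+
  let ?A = "P \<union> W \<union> J"
  have AL: "?A \<subseteq> L" using PL W(2) \<open>I \<subseteq> L\<close> \<open>J \<subseteq> L\<close> by blast
  have neg: "lie_bracket y x \<in> map.span ?A" if "lie_bracket x y \<in> map.span ?A" for x y
    using map.span_neg[OF that] lie_bracket_swap by metis
  have JA: "x \<in> map.span ?A" if "x \<in> J" for x using that by (blast intro: map.span_base)
  have LJ: "lie_bracket x y \<in> map.span ?A" if "x \<in> L" "y \<in> J" for x y
    using that J JA unfolding lie_ideal_def by blast
  have PP: "lie_bracket p q \<in> map.span ?A" if "p \<in> P" "q \<in> P" for p q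
  proof -
    have "lie_bracket p q - a p q \<in> map.span ?A"
      using a(2)[OF that] map.span_mono[of P ?A] by blast
    moreover have "a p q \<in> map.span ?A" using that W(3) by (blast intro: map.span_base)
    ultimately have "lie_bracket p q - a p q + a p q \<in> map.span ?A" by (rule map.span_add)
    then show ?thesis by simp
  qed
  have PW: "lie_bracket p y \<in> map.span ?A" if "p \<in> P" "y \<in> W" for p y
  proof -
    obtain t where "t \<in> ?T" "y \<in> Y t" using \<open>y \<in> W\<close> unfolding W_def by blast
    moreover from this have "map.span (Y t \<union> J) \<subseteq> map.span ?A"
      unfolding W_def by (intro map.span_mono) blast
    ultimately show ?thesis using Y(2) that(1) by blast
  qed
  have WW: "lie_bracket x y \<in> map.span ?A" if "x \<in> W" "y \<in> W" for x y
    using that W(2) IJ JA by blast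
  have "bracket_closed (map.span ?A)"
  proof (rule bracket_closed_span)
    show "?A \<subseteq> Der" using AL LD by blast
    fix x y assume "x \<in> ?A" "y \<in> ?A"
    then consider "x \<in> J" | "y \<in> J" | "x \<in> P" "y \<in> P" | "x \<in> P" "y \<in> W" | "x \<in> W" "y \<in> P"
      | "x \<in> W" "y \<in> W" by blast
    then show "lie_bracket x y \<in> map.span ?A"
      using LJ PP PW WW neg AL \<open>x \<in> ?A\<close> \<open>y \<in> ?A\<close> by cases blast+
  qed
  moreover have "H \<subseteq> map.span ?A" using P(3) by (blast intro: map.span_base)
  ultimately have NA: "N \<subseteq> map.span ?A" using gen by blast
  obtain P' where P': "finite P'" "P' \<subseteq> N" "P \<union> W \<subseteq> map.span P'"
  proof (rule map.finite_span_subset[of "P \<union> W" N])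
    show "P \<union> W \<subseteq> map.span N" using P(2) W(2) by (blast intro: map.span_base)
  qed (use P(1) W(1) in auto)
  have "?A \<subseteq> map.span (P' \<union> J)"
    using P'(3) map.span_mono[of P' "P' \<union> J"] map.span_superset[of "P' \<union> J"] by blast
  then have "map.span ?A \<subseteq> map.span (P' \<union> J)"
    by (intro map.span_minimal map.subspace_span)
  with NA P'(1,2) that show thesis by blast
qed

proposition solvable_finitely_spanned:
  assumes "derivation_finite" and L: "lie_subalgebra L" "lie_solvable L"
    and H: "finite H" and N: "bracket_closed hull H \<subseteq> LFD" "bracket_closed hull H \<subseteq> L"
  obtains P where "finite P" "P \<subseteq> bracket_closed hull H" "bracket_closed hull H \<subseteq> map.span P"
proof -
  let ?N = "bracket_closed hull H"
  have HN: "H \<subseteq> ?N" by (rule hull_subset)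
  have "\<exists>P. finite P \<and> P \<subseteq> ?N \<and> ?N \<subseteq> map.span (P \<union> derived_series L n)" for n
  proof (induction n)
    case 0
    then show ?case using N(2) map.span_superset[of L] by (intro exI[of _ "{}"]) auto
  next
    case (Suc n)
    then obtain P where P: "finite P" "P \<subseteq> ?N" "?N \<subseteq> map.span (P \<union> derived_series L n)" by blast
    let ?P = "H \<union> P"
    have "map.span (P \<union> derived_series L n) \<subseteq> map.span (?P \<union> derived_series L n)"
      by (rule map.span_mono) blast
    then have PN: "?N \<subseteq> map.span (?P \<union> derived_series L n)" using P(3) by blast
    show ?case
    proof (rule finitely_spanned_modulo_step[OF N(1) bracket_closed_hull N(2) L(1) assms(1)
          lie_ideal_derived_series[OF L(1), of n] lie_ideal_derived_series[OF L(1), of "Suc n"]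
          _ _ _ _ _ PN])
      show "lie_bracket x y \<in> derived_series L (Suc n)"
        if "x \<in> derived_series L n" "y \<in> derived_series L n" for x y
        using that by (simp add: lie_bracket_in_lie_derived)
      show "?N \<subseteq> map.span A" if "H \<subseteq> map.span A" "bracket_closed (map.span A)" for A
        using that by (rule hull_minimal)
    qed (use H P HN in auto)
  qed
  moreover obtain d where "derived_series L d = {0}"
    using L(2) unfolding lie_solvable_def by blast
  ultimately obtain P where "finite P" "P \<subseteq> ?N" "?N \<subseteq> map.span (P \<union> {0})" by metis
  then show thesis using that[of P] map.span_insert_0[of P] by simp
qed

section \<open>Local finiteness of solvable Lie algebras of derivations\<close>

lemma locally_finite_of_finite_spanning_set:
  assumes P: "finite P" "P \<subseteq> LFD" "\<And>p q. p \<in> P \<Longrightarrow> q \<in> P \<Longrightarrow> lie_bracket p q \<in> map.span P"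
  shows "locally_finite (map.span P)"
  unfolding locally_finite_def
proof
  fix b
  obtain Y where Y: "finite Y" "b \<in> Y" "\<And>p y. p \<in> P \<Longrightarrow> y \<in> Y \<Longrightarrow> p y \<in> span (Y \<union> {})"
  proof (rule almost_commuting_finite_invariant[of P "\<lambda>p. p" b UNIV "{}"])
    show "finite P" by fact
    fix p assume p: "p \<in> P"
    then have D: "p \<in> Der" "locally_finite {p}" using P(2) by (auto simp: LFD_def)
    show "Vector_Spaces.linear scale scale p" by (rule Der_linear[OF D(1)])
    obtain X where X: "finite X" "b \<in> span X" "p ` span X \<subseteq> span X"
      using D(2) unfolding locally_finite_def by auto
    have "(p ^^ n) b \<in> span X" for n by (induction n) (use X in auto)
    then show "\<exists>X. finite X \<and> (\<forall>n. (p ^^ n) b \<in> span X)" using X(1) by blast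
    fix q v assume "q \<in> P"
    have "lie_bracket p q v \<in> span ((\<lambda>l. l v) ` P \<union> {})"
      by (rule eval_span_into[OF P(3)[OF p \<open>q \<in> P\<close>] subspace_span]) (auto intro: span_base)
    then show "p (q v) - q (p v) \<in> span ((\<lambda>l. l v) ` P \<union> {})" by (simp add: lie_bracket_def)
  qed auto
  show "\<exists>U. subspace U \<and> (\<exists>X. finite X \<and> U = span X) \<and> b \<in> U \<and> (\<forall>D\<in>map.span P. D ` U \<subseteq> U)"
  proof (intro exI conjI ballI)
    show "finite Y" "span Y = span Y" "b \<in> span Y" using Y span_base by auto
    fix D assume D: "D \<in> map.span P"
    show "D ` span Y \<subseteq> span Y"
    proof (rule image_subsetI, rule eval_span_into[OF D subspace_span])
      fix x p assume x: "x \<in> span Y" and p: "p \<in> P"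
      show "p x \<in> span Y"
        by (rule linear_maps_span_into[OF Der_linear subspace_span _ x])
          (use Y(3) p P(2) in \<open>auto simp: LFD_def\<close>)
    qed
  qed simp
qed

end

theorem corollary2:
  fixes scale :: "'k::field \<Rightarrow> 'b::ab_group_add \<Rightarrow> 'b"
    and mult :: "'b \<Rightarrow> 'b \<Rightarrow> 'b"
    and L :: "('b \<Rightarrow> 'b) set"
  assumes "nonassoc_algebra scale mult"
    and "nonassoc_algebra.derivation_finite scale mult"
    and "nonassoc_algebra.lie_subalgebra scale mult L"
    and "nonassoc_algebra.lie_solvable scale mult L"
    and "\<exists>G. nonassoc_algebra.lie_generated scale mult G = L
           \<and> G \<subseteq> nonassoc_algebra.LFD scale mult \<and> bracket_closed G"
  shows "nonassoc_algebra.weakly_locally_finite scale L"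
proof -
  interpret nonassoc_algebra scale mult by fact
  obtain G where G: "lie_generated G = L" "G \<subseteq> LFD" "bracket_closed G"
    using assms(5) by blast
  have "G \<subseteq> Der" using G(2) by (auto simp: LFD_def)
  then have L: "L = map.span G" using lie_generated_bracket_closed[OF _ G(3)] G(1) by blast
  show ?thesis
    unfolding weakly_locally_finite_def
  proof (intro allI impI)
    fix \<Phi> assume "finite \<Phi> \<and> \<Phi> \<subseteq> L"
    then obtain H where H: "finite H" "H \<subseteq> G" "\<Phi> \<subseteq> map.span H"
      using map.finite_span_subset[of \<Phi> G] L by blast
    let ?N = "bracket_closed hull H"
    have NG: "?N \<subseteq> G" using H(2) G(3) by (rule hull_minimal)
    have "G \<subseteq> L" unfolding L by (rule map.span_superset)
    obtain P where P: "finite P" "P \<subseteq> ?N" "?N \<subseteq> map.span P"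
      by (rule solvable_finitely_spanned[OF assms(2-4) H(1)]) (use NG G(2) \<open>G \<subseteq> L\<close> in auto)
    have "locally_finite (map.span P)"
    proof (rule locally_finite_of_finite_spanning_set)
      show "finite P" "P \<subseteq> LFD" using P(1,2) NG G(2) by auto
      show "lie_bracket p q \<in> map.span P" if "p \<in> P" "q \<in> P" for p q
        using that P(2,3) bracket_closed_hull[of H] unfolding bracket_closed_def by blast
    qed
    moreover have "\<Phi> \<subseteq> map.span P"
    proof -
      have "H \<subseteq> map.span P" using hull_subset[of H bracket_closed] P(3) by (rule subset_trans)
      then have "map.span H \<subseteq> map.span P" by (rule map.span_minimal[OF _ map.subspace_span])
      then show ?thesis using H(3) by blast
    qed
    ultimately show "locally_finite \<Phi>"
      unfolding locally_finite_def by (meson subsetD)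
  qed
qed

end
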